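(* Let $\mathcal{S}=\langle\mathcal{L},\vdash\rangle$ be a structural logic, with $\mathcal{L}$ a formula algebra over a denumerable set of variables $V$. If there is no falsity constant for $\mathcal{S}$ in $\mathcal{L}$, then $\mathcal{S}^{pl}$ is NF-paraconsistent. Moreover, if in addition there exists $\varphi\in\mathcal{L}$ such that $\emptyset\not\vdash\varphi$, then $\mathcal{S}^{l}$ is also NF-paraconsistent.
   Context: A logic is a pair $\langle\mathcal{L},\vdash\rangle$ with $\vdash\,\subseteq\mathcal{P}(\mathcal{L})\times\mathcal{L}$, and $C_\vdash(\Gamma)=\{\alpha:\Gamma\vdash\alpha\}$. $\mathcal{L}$ is the formula algebra over a denumerable set $V$ of variables in a finite signature. A substitution is an endomorphism $\sigma$ of $\mathcal{L}$ (determined by any map $V\to\mathcal{L}$). $\mathcal{S}$ is structural if $\Gamma\vdash\varphi$ implies $\sigma(\Gamma)\vdash\sigma(\varphi)$ for every substitution $\sigma$. $\mathrm{var}(\alpha)$ is the set of variables in $\alpha$; $\mathrm{var}(\Delta)=\bigcup_{\alpha\in\Delta}\mathrm{var}(\alpha)$. A falsity constant is a constant $\bot\in\mathcal{L}$ (with $\mathrm{var}(\bot)=\emptyset$) such that $\{\bot\}\vdash\alpha$ for all $\alpha\in\mathcal{L}$. $\mathcal{S}^l=\langle\mathcal{L},\vdash^l\rangle$ where $\Gamma\vdash^l\alpha$ iff there is $\Delta\subseteq\Gamma$ with $\mathrm{var}(\Delta)\subseteq\mathrm{var}(\alpha)$ and $\Delta\vdash\alpha$; $\mathcal{S}^{pl}=\langle\mathcal{L},\vdash^{pl}\rangle$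 is defined the same way but requiring $\Delta\neq\emptyset$. A logic is NF-paraconsistent if there exists $\alpha\in\mathcal{L}$ such that $C_\vdash(\{\alpha,\beta\})\neq\mathcal{L}$ for every $\beta\in\mathcal{L}$.
   Formalization: A falsity constant is taken to be any variable-free formula ⊥ with {⊥}⊢α for all α, not only a nullary symbol; with nullary symbols only the claim fails (constant c, unary f, and only {f(c)} entailing every formula). *)

theory Defs
  imports Main "HOL-Library.Countable_Set"
begin

datatype ('f, 'v) fm = Var 'v | Op 'f "('f, 'v) fm list"

fun var :: "('f, 'v) fm \<Rightarrow> 'v set" where
  "var (Var x) = {x}"
| "var (Op f ts) = (\<Union>t\<in>set ts. var t)"

definition var_set :: "('f, 'v) fm set \<Rightarrow> 'v set" where
  "var_set \<Delta> = (\<Union>\<alpha>\<in>\<Delta>. var \<alpha>)"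

text \<open>The raw datatype ignores arities; the formula algebra over the variables \<open>V\<close> in the
  signature \<open>F\<close> with arity function \<open>ar\<close> is the following set of well-formed terms.\<close>

inductive_set formulas :: "'f set \<Rightarrow> ('f \<Rightarrow> nat) \<Rightarrow> 'v set \<Rightarrow> ('f, 'v) fm set"
  for F :: "'f set" and ar :: "'f \<Rightarrow> nat" and V :: "'v set" where
  Var: "x \<in> V \<Longrightarrow> Var x \<in> formulas F ar V"
| Op: "f \<in> F \<Longrightarrow> length ts = ar f \<Longrightarrow> (\<And>t. t \<in> set ts \<Longrightarrow> t \<in> formulas F ar V)
    \<Longrightarrow> Op f ts \<in> formulas F ar V"

text \<open>Endomorphisms of the formula algebra; only the values on well-formed formulas matter.\<close>

definition substitution ::
  "'f set \<Rightarrow> ('f \<Rightarrow> nat) \<Rightarrow> 'v set \<Rightarrow> (('f, 'v) fm \<Rightarrow> ('f, 'v) fm) \<Rightarrow> bool" where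
  "substitution F ar V \<sigma> \<longleftrightarrow>
     (\<forall>\<phi>\<in>formulas F ar V. \<sigma> \<phi> \<in> formulas F ar V) \<and>
     (\<forall>f\<in>F. \<forall>ts. length ts = ar f \<and> set ts \<subseteq> formulas F ar V
        \<longrightarrow> \<sigma> (Op f ts) = Op f (map \<sigma> ts))"

text \<open>No Tarskian condition (reflexivity, monotonicity, transitivity) is imposed on a logic.\<close>

definition is_logic :: "'a set \<Rightarrow> ('a set \<times> 'a) set \<Rightarrow> bool" where
  "is_logic L R \<longleftrightarrow> R \<subseteq> Pow L \<times> L"

definition Cn :: "('a set \<times> 'a) set \<Rightarrow> 'a set \<Rightarrow> 'a set" where
  "Cn R \<Gamma> = {\<alpha>. (\<Gamma>, \<alpha>) \<in> R}"

definition structural ::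
  "'f set \<Rightarrow> ('f \<Rightarrow> nat) \<Rightarrow> 'v set \<Rightarrow> (('f, 'v) fm set \<times> ('f, 'v) fm) set \<Rightarrow> bool" where
  "structural F ar V R \<longleftrightarrow>
     (\<forall>\<sigma>. substitution F ar V \<sigma> \<longrightarrow> (\<forall>\<Gamma> \<phi>. (\<Gamma>, \<phi>) \<in> R \<longrightarrow> (\<sigma> ` \<Gamma>, \<sigma> \<phi>) \<in> R))"

text \<open>A constant is any variable-free formula, not only a nullary symbol of the signature.\<close>

definition falsity_constant ::
  "('f, 'v) fm set \<Rightarrow> (('f, 'v) fm set \<times> ('f, 'v) fm) set \<Rightarrow> ('f, 'v) fm \<Rightarrow> bool" where
  "falsity_constant L R b \<longleftrightarrow> b \<in> L \<and> var b = {} \<and> (\<forall>\<alpha>\<in>L. ({b}, \<alpha>) \<in> R)"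

definition left_companion ::
  "('f, 'v) fm set \<Rightarrow> (('f, 'v) fm set \<times> ('f, 'v) fm) set \<Rightarrow> (('f, 'v) fm set \<times> ('f, 'v) fm) set" where
  "left_companion L R = {(\<Gamma>, \<alpha>). \<Gamma> \<subseteq> L \<and> \<alpha> \<in> L \<and>
     (\<exists>\<Delta>\<subseteq>\<Gamma>. var_set \<Delta> \<subseteq> var \<alpha> \<and> (\<Delta>, \<alpha>) \<in> R)}"

definition pure_left_companion ::
  "('f, 'v) fm set \<Rightarrow> (('f, 'v) fm set \<times> ('f, 'v) fm) set \<Rightarrow> (('f, 'v) fm set \<times> ('f, 'v) fm) set" where
  "pure_left_companion L R = {(\<Gamma>, \<alpha>). \<Gamma> \<subseteq> L \<and> \<alpha> \<in> L \<and>
     (\<exists>\<Delta>\<subseteq>\<Gamma>. \<Delta> \<noteq> {} \<and> var_set \<Delta> \<subseteq> var \<alpha> \<and> (\<Delta>, \<alpha>) \<in> R)}"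

definition NF_paraconsistent :: "'a set \<Rightarrow> ('a set \<times> 'a) set \<Rightarrow> bool" where
  "NF_paraconsistent L R \<longleftrightarrow> (\<exists>\<alpha>\<in>L. \<forall>\<beta>\<in>L. Cn R {\<alpha>, \<beta>} \<noteq> L)"

end

theory Submission
  imports Defs
begin

text \<open>
  A single variable \<open>x\<close> witnesses paraconsistency, and for each \<open>\<beta>\<close> a fresh variable \<open>y\<close> is not a
  consequence of \<open>{x, \<beta>}\<close>: premises using only the variable \<open>y\<close> must lie in \<open>{\<beta>}\<close>, with \<open>\<beta>\<close>
  variable-free. Substituting an arbitrary formula for \<open>y\<close> fixes such premises, so if they
  entailed \<open>y\<close>, they would entail every formula; thus \<open>\<beta>\<close> would be a falsity constant, or every
  formula would be a theorem.
\<close>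

fun subst_fm :: "('v \<Rightarrow> ('f, 'v) fm) \<Rightarrow> ('f, 'v) fm \<Rightarrow> ('f, 'v) fm" where
  "subst_fm s (Var x) = s x"
| "subst_fm s (Op f ts) = Op f (map (subst_fm s) ts)"

lemma subst_fm_in_formulas:
  assumes "\<phi> \<in> formulas F ar V" and "\<And>x. x \<in> V \<Longrightarrow> s x \<in> formulas F ar V"
  shows "subst_fm s \<phi> \<in> formulas F ar V"
  using assms
proof (induction \<phi>)
  case (Op f ts)
  then have "Op f (map (subst_fm s) ts) \<in> formulas F ar V"
    by (intro formulas.Op) auto
  then show ?case
    by simp
qed simp

lemma substitution_subst_fm:
  assumes "\<And>x. x \<in> V \<Longrightarrow> s x \<in> formulas F ar V"
  shows "substitution F ar V (subst_fm s)"
  using subst_fm_in_formulas[OF _ assms] by (auto simp: substitution_def)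

lemma subst_fm_closed: "var \<phi> = {} \<Longrightarrow> subst_fm s \<phi> = \<phi>"
  by (induction \<phi>) (auto intro: map_idI)

lemma finite_var: "finite (var \<phi>)"
  by (induction \<phi>) auto

text \<open>Structurality is applied to a substitution that moves only \<open>y\<close>:
  variable-free premises are unchanged, while the conclusion becomes the given formula.\<close>

lemma closed_premises_entail_all:
  assumes "structural F ar V R" and "(\<Delta>, Var y) \<in> R" and "var_set \<Delta> = {}"
    and "\<phi> \<in> formulas F ar V"
  shows "(\<Delta>, \<phi>) \<in> R"
proof -
  \<comment> \<open>The constructor \<open>Var\<close> acts as the identity assignment, here updated
    at \<open>y\<close>.\<close>
  define \<sigma> where "\<sigma> = subst_fm (Var(y := \<phi>))"
  have "substitution F ar V \<sigma>"
    unfolding \<sigma>_def using assms(4) by (intro substitution_subst_fm) (auto intro: formulas.Var)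
  then have "(\<sigma> ` \<Delta>, \<sigma> (Var y)) \<in> R"
    using assms(1,2) by (simp add: structural_def)
  moreover have "\<sigma> \<delta> = \<delta>" if "\<delta> \<in> \<Delta>" for \<delta>
    using that assms(3) by (auto simp: \<sigma>_def var_set_def intro: subst_fm_closed)
  then have "\<sigma> ` \<Delta> = \<Delta>"
    by force
  ultimately show ?thesis
    by (simp add: \<sigma>_def)
qed

text \<open>The bound on \<open>var_set \<Delta>\<close> excludes \<open>Var x\<close> and, since
  \<open>y\<close> is fresh for \<beta>, admits \<beta> only if it is variable-free; then
  \<open>{\<beta>}\<close> entailing \<open>Var y\<close> would make \<beta> a falsity
  constant.\<close>

lemma fresh_variable_premises:
  assumes "structural F ar V R" and "\<not> (\<exists>b. falsity_constant (formulas F ar V) R b)"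
    and "\<beta> \<in> formulas F ar V" and "y \<noteq> x" and "y \<notin> var \<beta>"
    and "\<Delta> \<subseteq> {Var x, \<beta>}" and "var_set \<Delta> \<subseteq> {y}" and "(\<Delta>, Var y) \<in> R"
  shows "\<Delta> = {}"
proof (rule ccontr)
  assume "\<Delta> \<noteq> {}"
  have "Var x \<notin> \<Delta>"
    using assms(4,7) by (force simp: var_set_def)
  with \<open>\<Delta> \<noteq> {}\<close> assms(6) have \<Delta>: "\<Delta> = {\<beta>}"
    by auto
  with assms(5,7) have closed: "var \<beta> = {}"
    by (auto simp: var_set_def)
  have "({\<beta>}, \<phi>) \<in> R" if "\<phi> \<in> formulas F ar V" for \<phi>
    using closed_premises_entail_all[OF assms(1) _ _ that] assms(8) closed
    by (simp add: \<Delta> var_set_def)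
  then show False
    using assms(2,3) closed by (auto simp: falsity_constant_def)
qed

theorem theorem2p19:
  fixes F :: "'f set" and ar :: "'f \<Rightarrow> nat" and V :: "'v set"
    and L :: "('f, 'v) fm set" and R :: "(('f, 'v) fm set \<times> ('f, 'v) fm) set"
  assumes "finite F" and "countable V" and "infinite V"
    and "L = formulas F ar V"
    and "is_logic L R"
    and "structural F ar V R"
    and "\<not> (\<exists>b. falsity_constant L R b)"
  shows "NF_paraconsistent L (pure_left_companion L R) \<and>
    ((\<exists>\<phi>\<in>L. ({}, \<phi>) \<notin> R) \<longrightarrow> NF_paraconsistent L (left_companion L R))"
proof -
  obtain x where "x \<in> V"
    using assms(3) by (metis ex_in_conv finite.emptyI)
  then have x: "Var x \<in> L"
    by (simp add: assms(4) formulas.Var)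
  \<comment> \<open>Here \<open>x\<close> is fixed before \<beta>, whereas \<open>y\<close> depends
    on \<beta>. The case of empty \<Delta> stays open, and only there do the two companions
    differ.\<close>
  have fresh: "\<exists>y. Var y \<in> L \<and> (\<forall>\<Delta> \<subseteq> {Var x, \<beta>}. var_set \<Delta> \<subseteq> {y} \<longrightarrow> (\<Delta>, Var y) \<in> R \<longrightarrow> \<Delta> = {})"
    if "\<beta> \<in> L" for \<beta>
  proof -
    obtain y where "y \<in> V" and "y \<notin> insert x (var \<beta>)"
      using assms(3) finite_var[of \<beta>] by (meson finite.insertI finite_subset subsetI)
    then show ?thesis
      using fresh_variable_premises[OF assms(6) assms(7)[unfolded assms(4)], of \<beta> y x] that
      by (auto simp: assms(4) intro: formulas.Var)
  qed
  have "NF_paraconsistent L (pure_left_companion L R)"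
    unfolding NF_paraconsistent_def
  proof (intro bexI[OF _ x] ballI)
    fix \<beta> assume "\<beta> \<in> L"
    then obtain y where "Var y \<in> L"
      and "\<forall>\<Delta> \<subseteq> {Var x, \<beta>}. var_set \<Delta> \<subseteq> {y} \<longrightarrow> (\<Delta>, Var y) \<in> R \<longrightarrow> \<Delta> = {}"
      using fresh by blast
    \<comment> \<open>The pure companion rules out the empty premise set by definition.\<close>
    then have "Var y \<in> L - Cn (pure_left_companion L R) {Var x, \<beta>}"
      unfolding Cn_def pure_left_companion_def by auto
    then show "Cn (pure_left_companion L R) {Var x, \<beta>} \<noteq> L"
      by blast
  qed
  moreover have "NF_paraconsistent L (left_companion L R)" if "\<phi> \<in> L" and "({}, \<phi>) \<notin> R" for \<phi>
    unfolding NF_paraconsistent_def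
  proof (intro bexI[OF _ x] ballI)
    fix \<beta> assume "\<beta> \<in> L"
    then obtain y where "Var y \<in> L"
      and "\<forall>\<Delta> \<subseteq> {Var x, \<beta>}. var_set \<Delta> \<subseteq> {y} \<longrightarrow> (\<Delta>, Var y) \<in> R \<longrightarrow> \<Delta> = {}"
      using fresh by blast
    \<comment> \<open>Empty premises are now allowed, but if they entailed a variable they would
      entail every formula, including \<phi>.\<close>
    moreover have "({}, Var y) \<notin> R"
      using closed_premises_entail_all[OF assms(6), of "{}" y \<phi>] that
      by (auto simp: assms(4) var_set_def)
    ultimately have "Var y \<in> L - Cn (left_companion L R) {Var x, \<beta>}"
      unfolding Cn_def left_companion_def by auto
    then show "Cn (left_companion L R) {Var x, \<beta>} \<noteq> L"
      by blast
  qed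
  ultimately show ?thesis
    by blast
qed

end
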